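(* Let $X$ be a commutative ring with an equivalence relation $\sim$ such that the canonical surjection $X\to X/\!\sim$, $x\mapsto [x]_m$, is a surjective morphism of rings. Let $k\ge 1$, let $f:X^k\to X$ be a linear map, $f(x_1,\ldots,x_k)=\sum_{j=1}^k f_j x_j$ with $f_1,\ldots,f_k\in X$, and let $(a_n)_{n\ge 1}$ be the sequence in $X$ with given initial values $a_1,\ldots,a_k$ and $a_{i+k}=f(a_i,\ldots,a_{i+k-1})$ for all $i\ge 1$. Suppose $\ell(m)$ is a positive integer such that $$[a_{j+\ell(m)}]_m=[a_j]_m\quad\text{for } j=1,\ldots,k.$$ Then $a$ is a periodic sequence modulo $m$, with $\ell(m)$ as a period: $[a_{n+\ell(m)}]_m=[a_n]_m$ for all $n\ge 1$.
   Context: $[x]_m$ denotes the class of $x\in X$ in $X/\!\sim$; in the basic case $X=\mathbb{Z}$, $m$ is a positive integer, $\sim$ is congruence modulo $m$ and $[x]_m$ is the residue class of $x$ in $\mathbb{Z}/m\mathbb{Z}$. A sequence $(a_n)$ is called periodic modulo $m$ if there is at least one positive integer $\ell(m)$ (called a period of $a$ modulo $m$) such that $[a_n]_m=[a_{n+\ell(m)}]_m$ for all indices $n$. *)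

theory Defs
  imports "HOL-Algebra.Ring"
begin

text \<open>
  Sequences are indexed by the positive integers: the value at \<open>0\<close> of a function on
  \<^typ>\<open>nat\<close> plays no role. The class \<open>[x]\<^sub>m\<close> with respect to a relation \<open>r\<close> is \<open>r `` {x}\<close>.
\<close>

definition linear_form ::
    "('a, 'b) ring_scheme \<Rightarrow> nat \<Rightarrow> (nat \<Rightarrow> 'a) \<Rightarrow> (nat \<Rightarrow> 'a) \<Rightarrow> 'a" where
  "linear_form X k c x = (\<Oplus>\<^bsub>X\<^esub>j\<in>{1..k}. c j \<otimes>\<^bsub>X\<^esub> x j)"

definition is_period_mod :: "('a \<times> 'a) set \<Rightarrow> (nat \<Rightarrow> 'a) \<Rightarrow> nat \<Rightarrow> bool" where
  "is_period_mod r a l \<longleftrightarrow> l > 0 \<and> (\<forall>n\<ge>1. r `` {a n} = r `` {a (n + l)})"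

definition periodic_mod :: "('a \<times> 'a) set \<Rightarrow> (nat \<Rightarrow> 'a) \<Rightarrow> bool" where
  "periodic_mod r a \<longleftrightarrow> (\<exists>l. is_period_mod r a l)"

end

theory Submission
  imports Defs
begin

text \<open>
  A ring homomorphism commutes with the operations from which a linear form is built, so the
  class of \<open>f(x\<^sub>1, \<dots>, x\<^sub>k)\<close> depends only on the classes of the arguments \<open>x\<^sub>1, \<dots>, x\<^sub>k\<close>
  (\<open>ring_hom_linear_form_cong\<close>). Since each term beyond the first \<open>k\<close> is the same linear form in
  the \<open>k\<close> preceding terms, the first \<open>k\<close> classes determine the whole sequence of classes. The
  sequence shifted by \<open>l\<close> obeys the same recurrence and starts with the same \<open>k\<close> classes, so it
  has the same classes throughout: this is a strong induction on the index.
\<close>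

lemma ring_hom_finsum_cong:
  assumes "ring R" and h: "h \<in> ring_hom R S" and "finite A"
    and "\<And>j. j \<in> A \<Longrightarrow> u j \<in> carrier R" and "\<And>j. j \<in> A \<Longrightarrow> v j \<in> carrier R"
    and "\<And>j. j \<in> A \<Longrightarrow> h (u j) = h (v j)"
  shows "h (\<Oplus>\<^bsub>R\<^esub>j\<in>A. u j) = h (\<Oplus>\<^bsub>R\<^esub>j\<in>A. v j)"
proof -
  interpret ring R by fact
  from \<open>finite A\<close> assms(4-) show ?thesis
  proof (induction A rule: finite_induct)
    case empty
    show ?case by simp
  next
    case (insert b A)
    have "u \<in> A \<rightarrow> carrier R" "v \<in> A \<rightarrow> carrier R"
      using insert.prems by auto
    then show ?case
      using insert by (simp add: ring_hom_add[OF h])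
  qed
qed

lemma ring_hom_linear_form_cong:
  assumes "ring R" and h: "h \<in> ring_hom R S"
    and c: "\<And>j. j \<in> {1..k} \<Longrightarrow> c j \<in> carrier R"
    and x: "\<And>j. j \<in> {1..k} \<Longrightarrow> x j \<in> carrier R"
    and y: "\<And>j. j \<in> {1..k} \<Longrightarrow> y j \<in> carrier R"
    and eq: "\<And>j. j \<in> {1..k} \<Longrightarrow> h (x j) = h (y j)"
  shows "h (linear_form R k c x) = h (linear_form R k c y)"
proof -
  interpret ring R by fact
  show ?thesis
    unfolding linear_form_def
  proof (rule ring_hom_finsum_cong[OF \<open>ring R\<close> h])
    fix j assume j: "j \<in> {1..k}"
    show "h (c j \<otimes>\<^bsub>R\<^esub> x j) = h (c j \<otimes>\<^bsub>R\<^esub> y j)"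
      by (simp only: ring_hom_mult[OF h c[OF j] x[OF j]] ring_hom_mult[OF h c[OF j] y[OF j]] eq[OF j])
  qed (use c x y in auto)
qed

theorem theorem2p3:
  fixes X :: "('a, 'b) ring_scheme" and Q :: "('a set, 'c) ring_scheme"
    and r :: "('a \<times> 'a) set"
    and k l :: nat and f :: "nat \<Rightarrow> 'a" and a :: "nat \<Rightarrow> 'a"
  assumes "cring X"
    and "equiv (carrier X) r"
    and "ring Q" and "carrier Q = carrier X // r"
    and "(\<lambda>x. r `` {x}) \<in> ring_hom X Q"
    and "k \<ge> 1"
    and "\<And>j. j \<in> {1..k} \<Longrightarrow> f j \<in> carrier X"
    and "\<And>n. n \<ge> 1 \<Longrightarrow> a n \<in> carrier X"
    and "\<And>i. i \<ge> 1 \<Longrightarrow> a (i + k) = linear_form X k f (\<lambda>j. a (i + j - 1))"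
    and "l > 0"
    and "\<And>j. j \<in> {1..k} \<Longrightarrow> r `` {a (j + l)} = r `` {a j}"
  shows "periodic_mod r a \<and> is_period_mod r a l"
proof -
  have "ring X"
    using \<open>cring X\<close> by (rule cring.axioms(1))
  have "r `` {a (n + l)} = r `` {a n}" if "n \<ge> 1" for n
    using that
  proof (induction n rule: less_induct)
    case (less n)
    show ?case
    proof (cases "n \<le> k")
      case True
      then show ?thesis
        using assms(11) less.prems by simp
    next
      case False
      obtain i where i: "n = i + k" "i \<ge> 1"
        using False by (intro that[of "n - k"]) auto
      have "r `` {linear_form X k f (\<lambda>j. a (i + l + j - 1))} =
            r `` {linear_form X k f (\<lambda>j. a (i + j - 1))}"
      proof (rule ring_hom_linear_form_cong[OF \<open>ring X\<close> assms(5)])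
        fix j assume j: "j \<in> {1..k}"
        have "i + j - 1 < n" "i + j - 1 \<ge> 1"
          using i j by auto
        then have "r `` {a (i + j - 1 + l)} = r `` {a (i + j - 1)}"
          by (rule less.IH)
        moreover have "i + j - 1 + l = i + l + j - 1"
          using i by simp
        ultimately show "r `` {a (i + l + j - 1)} = r `` {a (i + j - 1)}"
          by simp
      qed (use assms(7,8) i in auto)
      moreover have "a (n + l) = linear_form X k f (\<lambda>j. a (i + l + j - 1))"
        using i assms(9)[of "i + l"] by (simp add: ac_simps)
      ultimately show ?thesis
        using i assms(9)[of i] by simp
    qed
  qed
  then have "is_period_mod r a l"
    using \<open>l > 0\<close> by (simp add: is_period_mod_def)
  then show ?thesis
    by (auto simp: periodic_mod_def)
qed

end
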